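(* Let $S \subset \mathbb{F}_2^n$, let $\tau, \delta \in (0,1)$, and let $m = \log_2(|S|(|S|-1)/\delta)$. Suppose $$|S| > 2^{20} m \max\left(\frac{2^8(1+\tau)^4}{(\tau\delta)^8},\, 1\right), \qquad m \geq 5\log_2\left(m\max\left(\frac{4(1+\tau)}{(\tau\delta)^2},\, 1\right)\right) + 25.$$ Then there exists a natural number $$t \geq \log_2|S| - 4\log_2\left(m\max\left(\frac{4(1+\tau)}{(\tau\delta)^2},\, 1\right)\right) - 20$$ such that at least a $(1-\delta)$-fraction of all surjective linear maps $L : \mathbb{F}_2^n \to \mathbb{F}_2^t$ are such that $L(U_S)$ is $\tau 2^{-t}$-close to uniform in the $\ell_\infty$ norm, i.e. $|\Pr[L(U_S)=y] - 2^{-t}| \leq \tau 2^{-t}$ for all $y \in \mathbb{F}_2^t$.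
   Context: $U_S$ denotes a random variable distributed uniformly on the finite set $S$. A random variable $X$ on a finite set $Y$ is $\epsilon$-close to uniform in the $\ell_\infty$ norm if $|\Pr[X=y] - 1/|Y|| \leq \epsilon$ for every $y \in Y$. *)

theory Defs
  imports "HOL-Analysis.Analysis" "HOL-Library.FuncSet"
begin

text \<open>The vector space F_2^n, modelled as boolean lists of length n
  (True = 1, False = 0); addition is coordinatewise xor.\<close>

definition F2vec :: "nat \<Rightarrow> bool list set" where
  "F2vec n = {xs. length xs = n}"

definition F2add :: "bool list \<Rightarrow> bool list \<Rightarrow> bool list" where
  "F2add xs ys = map2 (\<lambda>a b. a \<noteq> b) xs ys"

text \<open>Surjective linear maps F_2^n \<rightarrow> F_2^t, as extensional functions on the carrier
  (over F_2, linearity is additivity).\<close>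

definition surj_lin_maps :: "nat \<Rightarrow> nat \<Rightarrow> (bool list \<Rightarrow> bool list) set" where
  "surj_lin_maps n t = {L \<in> F2vec n \<rightarrow>\<^sub>E F2vec t.
      (\<forall>x\<in>F2vec n. \<forall>y\<in>F2vec n. L (F2add x y) = F2add (L x) (L y))
      \<and> L ` F2vec n = F2vec t}"

definition prob_image_unif :: "(bool list \<Rightarrow> bool list) \<Rightarrow> bool list set \<Rightarrow> bool list \<Rightarrow> real" where
  "prob_image_unif L S y = real (card {x\<in>S. L x = y}) / real (card S)"

definition close_unif_linf :: "(bool list \<Rightarrow> real) \<Rightarrow> bool list set \<Rightarrow> real \<Rightarrow> bool" where
  "close_unif_linf P Y eps \<longleftrightarrow> (\<forall>y\<in>Y. \<bar>P y - 1 / real (card Y)\<bar> \<le> eps)"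

end

theory Submission
  imports Defs
begin

text \<open>Nothing is lost by drawing L uniformly from all linear maps, since a non-surjective L misses
  some y and is therefore bad. Choose b with t <= 2^b < 2 t, let R be a further uniform linear map
  to F_2^b and let U be a uniform t * b matrix. Then P = L + U R is uniform and independent of R
  and U.

  Suppose L has a fibre S_y of deviating size. Given L, the map R is still uniform, so by the second
  moment method it splits S_y almost evenly, and with probability at least 1/2 each of the 2^b cells
  {x in S. L x = y, R x = s} is itself of deviating size. Such a cell is the fibre of (P, R) over
  (y + U s, s). Hence the coset {(y + U s, s)} of the random subspace {(U s, s)} lies within the set
  C of deviating cells of (P, R), which does not depend on U. Again by the second moment method C
  is sparse. Exposing the columns of U one by one, a column pairs up the slices of C and replaces
  each pair by the intersection of one with a random translate of the other, so the total density
  is squared on average at each step; after b steps it has dropped below 2^(-t), that is, no coset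
  is left. This trick of exhibiting L as a factor of a map with a larger range is due to Alon,
  Dietzfelbinger, Miltersen, Petrank and Tardos.\<close>

section \<open>Arithmetic in F_2^n\<close>

lemma finite_F2vec: "finite (F2vec n)"
  using finite_lists_length_eq[of "UNIV :: bool set" n] by (simp add: F2vec_def)

lemma card_F2vec: "card (F2vec n) = 2 ^ n"
  using card_lists_length_eq[of "UNIV :: bool set" n] by (simp add: F2vec_def)

lemma F2vec_0: "F2vec 0 = {[]}"
  by (auto simp: F2vec_def)

lemma F2vec_Suc: "F2vec (Suc k) = Cons False ` F2vec k \<union> Cons True ` F2vec k"
  by (auto simp: F2vec_def length_Suc_conv image_iff)

lemma sum_F2vec_Suc:
  fixes f :: "bool list \<Rightarrow> real"
  shows "(\<Sum>s\<in>F2vec (Suc k). f s) = (\<Sum>s\<in>F2vec k. f (False # s) + f (True # s))"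
proof -
  have "(\<Sum>s\<in>F2vec (Suc k). f s) = sum f (Cons False ` F2vec k) + sum f (Cons True ` F2vec k)"
    unfolding F2vec_Suc by (rule sum.union_disjoint) (auto simp: finite_F2vec)
  then show ?thesis by (simp add: sum.reindex sum.distrib)
qed

lemma length_F2add: "length xs = n \<Longrightarrow> length ys = n \<Longrightarrow> length (F2add xs ys) = n"
  by (simp add: F2add_def)

lemma nth_F2add: "length xs = n \<Longrightarrow> length ys = n \<Longrightarrow> i < n \<Longrightarrow> F2add xs ys ! i = (xs ! i \<noteq> ys ! i)"
  by (simp add: F2add_def)

lemma F2add_closed: "x \<in> F2vec n \<Longrightarrow> y \<in> F2vec n \<Longrightarrow> F2add x y \<in> F2vec n"
  by (simp add: F2vec_def length_F2add)

lemma F2add_commute: "x \<in> F2vec n \<Longrightarrow> y \<in> F2vec n \<Longrightarrow> F2add x y = F2add y x"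
  by (auto simp: F2vec_def length_F2add nth_F2add intro!: nth_equalityI)

lemma F2add_assoc:
  "x \<in> F2vec n \<Longrightarrow> y \<in> F2vec n \<Longrightarrow> z \<in> F2vec n \<Longrightarrow> F2add (F2add x y) z = F2add x (F2add y z)"
  by (auto simp: F2vec_def length_F2add nth_F2add intro!: nth_equalityI)

lemma F2add_left_commute:
  "x \<in> F2vec n \<Longrightarrow> y \<in> F2vec n \<Longrightarrow> z \<in> F2vec n \<Longrightarrow> F2add x (F2add y z) = F2add y (F2add x z)"
  by (auto simp: F2vec_def length_F2add nth_F2add intro!: nth_equalityI)

lemma F2add_cancel: "x \<in> F2vec n \<Longrightarrow> y \<in> F2vec n \<Longrightarrow> F2add (F2add x y) y = x"
  by (auto simp: F2vec_def length_F2add nth_F2add intro!: nth_equalityI)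

lemma F2zero_mem: "replicate n False \<in> F2vec n"
  by (simp add: F2vec_def)

lemma F2add_zero: "x \<in> F2vec n \<Longrightarrow> F2add x (replicate n False) = x"
  by (auto simp: F2vec_def length_F2add nth_F2add intro!: nth_equalityI)

lemma F2add_zero_left: "x \<in> F2vec n \<Longrightarrow> F2add (replicate n False) x = x"
  by (auto simp: F2vec_def length_F2add nth_F2add intro!: nth_equalityI)

lemma F2add_eq_zero_iff:
  "x \<in> F2vec n \<Longrightarrow> y \<in> F2vec n \<Longrightarrow> F2add x y = replicate n False \<longleftrightarrow> x = y"
  by (auto simp: F2vec_def length_F2add nth_F2add list_eq_iff_nth_eq)

lemma F2add_right_eq_iff:
  "x \<in> F2vec n \<Longrightarrow> y \<in> F2vec n \<Longrightarrow> z \<in> F2vec n \<Longrightarrow> F2add x z = F2add y z \<longleftrightarrow> x = y"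
  by (metis F2add_cancel)

lemma F2add_medial:
  assumes "a \<in> F2vec n" "b \<in> F2vec n" "c \<in> F2vec n" "d \<in> F2vec n"
  shows "F2add (F2add a b) (F2add c d) = F2add (F2add a c) (F2add b d)"
  using assms by (auto simp: F2vec_def length_F2add nth_F2add intro!: nth_equalityI)

section \<open>Linear maps: invariance under translation, and collisions of pairs\<close>

definition additive_on :: "nat \<Rightarrow> (bool list \<Rightarrow> bool list) \<Rightarrow> bool" where
  "additive_on n h \<longleftrightarrow> (\<forall>x\<in>F2vec n. \<forall>y\<in>F2vec n. h (F2add x y) = F2add (h x) (h y))"

definition lin_maps :: "nat \<Rightarrow> nat \<Rightarrow> (bool list \<Rightarrow> bool list) set" where
  "lin_maps n t = {L \<in> F2vec n \<rightarrow>\<^sub>E F2vec t. additive_on n L}"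

lemma finite_lin_maps: "finite (lin_maps n t)"
  unfolding lin_maps_def
  by (rule finite_subset[OF _ finite_PiE[of "F2vec n" "\<lambda>_. F2vec t"]]) (auto simp: finite_F2vec)

lemma lin_maps_mem: "L \<in> lin_maps n t \<Longrightarrow> x \<in> F2vec n \<Longrightarrow> L x \<in> F2vec t"
  by (auto simp: lin_maps_def)

lemma lin_maps_add:
  "L \<in> lin_maps n t \<Longrightarrow> x \<in> F2vec n \<Longrightarrow> y \<in> F2vec n \<Longrightarrow> L (F2add x y) = F2add (L x) (L y)"
  by (auto simp: lin_maps_def additive_on_def)

lemma lin_maps_nonempty: "lin_maps n t \<noteq> {}"
proof -
  have "(\<lambda>x\<in>F2vec n. replicate t False) \<in> lin_maps n t"
    by (auto simp: lin_maps_def additive_on_def F2zero_mem F2add_zero F2add_closed)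
  then show ?thesis by blast
qed

text \<open>Translation by h in the space of linear maps. Restriction to the carrier keeps the
  result extensional, so that for linear h it stays within \<open>lin_maps\<close>.\<close>

definition shift_map :: "nat \<Rightarrow> (bool list \<Rightarrow> bool list) \<Rightarrow> (bool list \<Rightarrow> bool list) \<Rightarrow> bool list \<Rightarrow> bool list" where
  "shift_map n h L = (\<lambda>x\<in>F2vec n. F2add (L x) (h x))"

lemma shift_map_apply: "x \<in> F2vec n \<Longrightarrow> shift_map n h L x = F2add (L x) (h x)"
  by (simp add: shift_map_def)

text \<open>Adding h twice cancels in characteristic 2, so the translation is its own inverse. Hence
  L + h is uniform whenever L is.\<close>

lemma bij_betw_shift_map:
  assumes h: "h \<in> F2vec n \<rightarrow> F2vec t" "additive_on n h"
  shows "bij_betw (shift_map n h) (lin_maps n t) (lin_maps n t)"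
proof (rule bij_betwI[where g = "shift_map n h"])
  show "shift_map n h \<in> lin_maps n t \<rightarrow> lin_maps n t"
  proof
    fix L assume L: "L \<in> lin_maps n t"
    have "shift_map n h L (F2add x y) = F2add (shift_map n h L x) (shift_map n h L y)"
      if "x \<in> F2vec n" "y \<in> F2vec n" for x y
      using that h L lin_maps_mem[OF L]
      by (auto simp: shift_map_apply F2add_closed lin_maps_add additive_on_def Pi_def intro!: F2add_medial[of _ t])
    moreover have "shift_map n h L \<in> F2vec n \<rightarrow>\<^sub>E F2vec t"
      using h lin_maps_mem[OF L] by (auto simp: shift_map_def intro!: F2add_closed)
    ultimately show "shift_map n h L \<in> lin_maps n t"
      by (simp add: lin_maps_def additive_on_def)
  qed
  then show "shift_map n h \<in> lin_maps n t \<rightarrow> lin_maps n t" .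
  fix L assume L: "L \<in> lin_maps n t"
  show "shift_map n h (shift_map n h L) = L"
  proof
    fix x
    show "shift_map n h (shift_map n h L) x = L x"
    proof (cases "x \<in> F2vec n")
      case True
      then show ?thesis
        using h lin_maps_mem[OF L True] by (simp add: shift_map_apply F2add_cancel[of _ t] Pi_def)
    next
      case False
      then show ?thesis using L by (auto simp: shift_map_def lin_maps_def PiE_def extensional_def)
    qed
  qed
  then show "shift_map n h (shift_map n h L) = L" .
qed

text \<open>Two distinct points collide with probability exactly 2^(-t): translating L by a suitable
  linear map shifts L x + L y by any prescribed a, so all 2^t values of L x + L y are equally
  frequent.\<close>

lemma lin_maps_universal:
  assumes x: "x \<in> F2vec n" and y: "y \<in> F2vec n" and ne: "x \<noteq> y"
  shows "card {L \<in> lin_maps n t. L x = L y} * 2 ^ t = card (lin_maps n t)"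
proof -
  obtain i where i: "i < n" "x ! i \<noteq> y ! i"
    using x y ne by (auto simp: F2vec_def list_eq_iff_nth_eq)
  let ?z = "replicate t False"
  define D where "D a = {L \<in> lin_maps n t. F2add (L x) (L y) = a}" for a
  have D0: "D ?z = {L \<in> lin_maps n t. L x = L y}"
    unfolding D_def using F2add_eq_zero_iff lin_maps_mem x y by blast
  have cardD: "card (D a) = card (D ?z)" if a: "a \<in> F2vec t" for a
  proof -
    \<comment> \<open>Reading off a coordinate i in which x and y differ yields a linear map with h
      x + h y = a.\<close>
    define h where "h v = (if v ! i then a else ?z)" for v :: "bool list"
    have h1: "h \<in> F2vec n \<rightarrow> F2vec t" using a by (auto simp: h_def F2zero_mem)
    have aa: "F2add a a = ?z" using F2add_cancel[OF F2zero_mem a] F2add_zero_left[OF a] by simp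
    have h2: "additive_on n h"
      unfolding additive_on_def
    proof (intro ballI)
      fix v w assume "v \<in> F2vec n" "w \<in> F2vec n"
      then have "F2add v w ! i = (v ! i \<noteq> w ! i)"
        using i by (simp add: F2vec_def nth_F2add)
      then show "h (F2add v w) = F2add (h v) (h w)"
        using a aa by (simp add: h_def F2add_zero F2add_zero_left F2zero_mem)
    qed
    have hxy: "F2add (h x) (h y) = a"
      using i a by (auto simp: h_def F2add_zero F2add_zero_left)
    have eq: "shift_map n h L \<in> D a \<longleftrightarrow> L \<in> D ?z" if L: "L \<in> lin_maps n t" for L
    proof -
      have "F2add (shift_map n h L x) (shift_map n h L y) = F2add (F2add (L x) (L y)) a"
        using F2add_medial[of "L x" t "h x" "L y" "h y"] h1 x y L hxy
        by (auto simp: shift_map_apply lin_maps_mem Pi_def)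
      moreover have "F2add (F2add (L x) (L y)) a = a \<longleftrightarrow> F2add (L x) (L y) = ?z"
        using F2add_right_eq_iff[of "F2add (L x) (L y)" t ?z a] a L x y
        by (auto simp: F2add_closed lin_maps_mem F2zero_mem F2add_zero_left)
      ultimately show ?thesis
        using bij_betwE[OF bij_betw_shift_map[OF h1 h2]] L by (auto simp: D_def)
    qed
    note bij = bij_betw_shift_map[OF h1 h2]
    have "shift_map n h ` D ?z = D a"
    proof
      show "shift_map n h ` D ?z \<subseteq> D a" using eq by (auto simp: D_def)
      show "D a \<subseteq> shift_map n h ` D ?z"
      proof
        fix L assume L: "L \<in> D a"
        then obtain L' where "L' \<in> lin_maps n t" "L = shift_map n h L'"
          using bij_betw_imp_surj_on[OF bij] by (auto simp: D_def)
        with L eq show "L \<in> shift_map n h ` D ?z" by blast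
      qed
    qed
    then have "bij_betw (shift_map n h) (D ?z) (D a)"
      by (intro bij_betw_subset[OF bij]) (auto simp: D_def)
    then show ?thesis by (simp add: bij_betw_same_card)
  qed
  have "card (lin_maps n t) = card (\<Union>a\<in>F2vec t. D a)"
    by (rule arg_cong[of _ _ card]) (auto simp: D_def F2add_closed lin_maps_mem x y)
  also have "\<dots> = (\<Sum>a\<in>F2vec t. card (D a))"
    by (rule card_UN_disjoint) (auto simp: finite_F2vec D_def finite_lin_maps)
  also have "\<dots> = 2 ^ t * card (D ?z)"
    by (simp add: cardD card_F2vec)
  finally show ?thesis by (simp add: D0)
qed

section \<open>The second moment method\<close>

lemma sum_card_filter_swap:
  assumes "finite A" "finite B"
  shows "(\<Sum>a\<in>A. real (card {b\<in>B. P a b})) = (\<Sum>b\<in>B. real (card {a\<in>A. P a b}))"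
proof -
  have "real (card {b\<in>B. P a b}) = (\<Sum>b\<in>B. of_bool (P a b))" for a
    using assms by (simp add: Int_def)
  moreover have "real (card {a\<in>A. P a b}) = (\<Sum>a\<in>A. of_bool (P a b))" for b
    using assms by (simp add: Int_def)
  ultimately show ?thesis by (simp only: sum.swap[of _ A B])
qed

text \<open>For fixed i the squared deviations add up to the number of colliding pairs minus |S|^2 /
  |Z|. Summed over H, the diagonal pairs give |H| |S|, and the pairs of distinct points at most
  cancel the subtracted term. The range Z is arbitrary because both single maps and pairs of maps
  are treated.\<close>

lemma second_moment:
  fixes h :: "'i \<Rightarrow> 'a \<Rightarrow> 'b"
  assumes fin: "finite H" "finite S" "finite Z"
    and maps: "\<And>i x. i \<in> H \<Longrightarrow> x \<in> S \<Longrightarrow> h i x \<in> Z"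
    and univ: "\<And>x y. x \<in> S \<Longrightarrow> y \<in> S \<Longrightarrow> x \<noteq> y \<Longrightarrow> card {i\<in>H. h i x = h i y} * card Z = card H"
  shows "(\<Sum>i\<in>H. \<Sum>z\<in>Z. (real (card {x\<in>S. h i x = z}) - card S / card Z)\<^sup>2) \<le> real (card H) * card S"
proof (cases "H = {} \<or> S = {}")
  case True
  then show ?thesis by auto
next
  case False
  then have "Z \<noteq> {}" using maps by blast
  then have Z: "real (card Z) > 0" using fin by (simp add: card_gt_0_iff)
  have inner: "(\<Sum>z\<in>Z. (real (card {x\<in>S. h i x = z}) - card S / card Z)\<^sup>2)
      = (\<Sum>x\<in>S. real (card {y\<in>S. h i x = h i y})) - (card S)\<^sup>2 / card Z" if i: "i \<in> H" for i
  proof -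
    let ?c = "\<lambda>z. real (card {x\<in>S. h i x = z})"
    have group: "(\<Sum>x\<in>S. g (h i x)) = (\<Sum>z\<in>Z. ?c z * g z)" for g :: "'b \<Rightarrow> real"
    proof -
      have "(\<Sum>x\<in>S. g (h i x)) = (\<Sum>z\<in>Z. \<Sum>x\<in>{x\<in>S. h i x = z}. g (h i x))"
        by (rule sum.group[symmetric]) (use fin maps i in auto)
      also have "\<dots> = (\<Sum>z\<in>Z. ?c z * g z)" by (intro sum.cong) auto
      finally show ?thesis .
    qed
    have tot: "(\<Sum>z\<in>Z. ?c z) = card S" using group[of "\<lambda>_. 1"] by simp
    \<comment> \<open>Ordered pairs are counted, including x = y.\<close>
    have sq: "(\<Sum>x\<in>S. real (card {y\<in>S. h i x = h i y})) = (\<Sum>z\<in>Z. (?c z)\<^sup>2)"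
      using group[of ?c] by (simp add: power2_eq_square eq_commute)
    have "(\<Sum>z\<in>Z. (?c z - card S / card Z)\<^sup>2)
       = (\<Sum>z\<in>Z. (?c z)\<^sup>2) - 2 * (card S / card Z) * (\<Sum>z\<in>Z. ?c z) + card Z * (card S / card Z)\<^sup>2"
      by (simp add: power2_diff sum.distrib sum_subtractf sum_distrib_left mult_ac)
    then show ?thesis using Z unfolding tot sq
      by (simp add: power2_eq_square field_simps)
  qed
  have pair: "(\<Sum>y\<in>S. real (card {i\<in>H. h i x = h i y})) \<le> card H + card S * card H / card Z"
    if x: "x \<in> S" for x
  proof -
    have "(\<Sum>y\<in>S. real (card {i\<in>H. h i x = h i y}))
        = card H + (\<Sum>y\<in>S - {x}. real (card {i\<in>H. h i x = h i y}))"
      using x fin by (simp add: sum.remove)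
    also have "(\<Sum>y\<in>S - {x}. real (card {i\<in>H. h i x = h i y})) = (\<Sum>y\<in>S - {x}. card H / card Z)"
    proof (rule sum.cong)
      fix y assume "y \<in> S - {x}"
      then have "real (card {i\<in>H. h i x = h i y}) * card Z = card H"
        using univ[of x y] x by (metis DiffE of_nat_mult singletonI)
      then show "real (card {i\<in>H. h i x = h i y}) = card H / card Z"
        using Z by (simp add: field_simps)
    qed simp
    \<comment> \<open>Putting the term for y = x back makes the sum over x cancel exactly against
      the subtracted square.\<close>
    also have "\<dots> \<le> (\<Sum>y\<in>S. card H / card Z)"
      by (rule sum_mono2) (use fin in auto)
    finally show ?thesis by simp
  qed
  have "(\<Sum>i\<in>H. \<Sum>z\<in>Z. (real (card {x\<in>S. h i x = z}) - card S / card Z)\<^sup>2)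
      = (\<Sum>i\<in>H. (\<Sum>x\<in>S. real (card {y\<in>S. h i x = h i y})) - (card S)\<^sup>2 / card Z)"
    by (rule sum.cong) (auto simp: inner)
  also have "\<dots> = (\<Sum>x\<in>S. \<Sum>i\<in>H. real (card {y\<in>S. h i x = h i y})) - card H * ((card S)\<^sup>2 / card Z)"
    by (simp add: sum_subtractf sum.swap[of _ H S])
  also have "(\<Sum>x\<in>S. \<Sum>i\<in>H. real (card {y\<in>S. h i x = h i y}))
      = (\<Sum>x\<in>S. \<Sum>y\<in>S. real (card {i\<in>H. h i x = h i y}))"
    by (intro sum.cong sum_card_filter_swap fin refl)
  also have "\<dots> \<le> (\<Sum>x\<in>S. card H + card S * card H / card Z)"
    by (rule sum_mono) (rule pair)
  also have "\<dots> = card S * card H + card H * ((card S)\<^sup>2 / card Z)"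
    by (simp add: algebra_simps power2_eq_square)
  finally show ?thesis by (simp add: algebra_simps)
qed


section \<open>Cosets of the graph of a random matrix inside a sparse set\<close>

text \<open>The list us holds the columns of the matrix U, and comb t us s is the product U s.\<close>

fun comb :: "nat \<Rightarrow> bool list list \<Rightarrow> bool list \<Rightarrow> bool list" where
  "comb t (u # us) (c # s) = (if c then F2add u (comb t us s) else comb t us s)"
| "comb t _ _ = replicate t False"

definition tuples :: "nat \<Rightarrow> nat \<Rightarrow> bool list list set" where
  "tuples t k = {us. length us = k \<and> set us \<subseteq> F2vec t}"

text \<open>C encodes, slice by slice, a subset of F_2^t x F_2^k. Every coset of the graph of U
  contains exactly one point (y, 0), so quantifying over y runs through all cosets.\<close>

definition covered :: "nat \<Rightarrow> (bool list \<Rightarrow> bool list set) \<Rightarrow> bool list list \<Rightarrow> bool" where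
  "covered t C us \<longleftrightarrow> (\<exists>y\<in>F2vec t. \<forall>s\<in>F2vec (length us). F2add y (comb t us s) \<in> C s)"

lemma finite_tuples: "finite (tuples t k)"
  and card_tuples: "card (tuples t k) = (2 ^ t) ^ k"
proof -
  have "tuples t k = {us. set us \<subseteq> F2vec t \<and> length us = k}"
    by (auto simp: tuples_def)
  then show "finite (tuples t k)" "card (tuples t k) = (2 ^ t) ^ k"
    using finite_lists_length_eq[of "F2vec t" k] card_lists_length_eq[of "F2vec t" k]
    by (auto simp: finite_F2vec card_F2vec)
qed

lemma comb_closed: "us \<in> tuples t k \<Longrightarrow> comb t us s \<in> F2vec t"
  by (induction t us s arbitrary: k rule: comb.induct)
    (auto simp: tuples_def F2zero_mem intro!: F2add_closed)

lemma additive_comb: 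
  assumes "us \<in> tuples t k"
  shows "additive_on k (comb t us)"
proof -
  have "comb t us (F2add x y) = F2add (comb t us x) (comb t us y)"
    if "x \<in> F2vec k" "y \<in> F2vec k" for x y
    using assms that
  proof (induction us arbitrary: k x y)
    case Nil
    then show ?case by (simp add: F2add_zero F2zero_mem)
  next
    case (Cons u us)
    then obtain k' where k: "k = Suc k'" and us: "us \<in> tuples t k'" and u: "u \<in> F2vec t"
      by (auto simp: tuples_def)
    with Cons.prems obtain a x' b y' where xy: "x = a # x'" "y = b # y'" and mem: "x' \<in> F2vec k'" "y' \<in> F2vec k'"
      by (auto simp: F2vec_def length_Suc_conv)
    note c = comb_closed[OF us]
    \<comment> \<open>For the case that both leading bits are set, where the two copies of the
      column cancel.\<close>
    have uu: "F2add u (F2add u w) = w" if "w \<in> F2vec t" for w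
      using that u by (metis F2add_assoc F2add_cancel F2add_closed F2add_commute)
    have add: "F2add x y = (a \<noteq> b) # F2add x' y'" by (simp add: xy F2add_def)
    define v w where "v = comb t us x'" and "w = comb t us y'"
    have vw: "v \<in> F2vec t" "w \<in> F2vec t" using c by (simp_all add: v_def w_def)
    have "comb t (u # us) (F2add x y) = (if a \<noteq> b then F2add u (F2add v w) else F2add v w)"
      using Cons.IH[OF us mem] by (simp add: add v_def w_def)
    also have "\<dots> = F2add (if a then F2add u v else v) (if b then F2add u w else w)"
      using u vw uu[of "F2add v w"] F2add_assoc[OF u vw] F2add_assoc[OF u vw(1), of "F2add u w"]
        F2add_left_commute[OF vw(1) u vw(2)]
      by (cases a; cases b) (simp_all add: F2add_closed)
    finally show ?case by (simp add: xy v_def w_def)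
  qed
  then show ?thesis by (simp add: additive_on_def)
qed

text \<open>A point z of A and a point w of B are joined by exactly one u, namely z + w. Thus
  intersecting A with a random translate of B multiplies the densities on average.\<close>

lemma sum_card_translates:
  assumes "A \<subseteq> F2vec t" "B \<subseteq> F2vec t"
  shows "(\<Sum>u\<in>F2vec t. real (card {z\<in>A. F2add u z \<in> B})) = real (card A) * real (card B)"
proof -
  have fin: "finite A" "finite B" using assms finite_F2vec finite_subset by blast+
  have "(\<Sum>u\<in>F2vec t. real (card {z\<in>A. F2add u z \<in> B}))
      = (\<Sum>z\<in>A. real (card {u\<in>F2vec t. F2add u z \<in> B}))"
    by (rule sum_card_filter_swap) (auto simp: fin finite_F2vec)
  also have "\<dots> = (\<Sum>z\<in>A. real (card B))"
  proof (rule sum.cong)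
    fix z assume "z \<in> A"
    then have z: "z \<in> F2vec t" using assms by blast
    have "bij_betw (\<lambda>u. F2add u z) {u\<in>F2vec t. F2add u z \<in> B} B"
      by (rule bij_betwI[where g = "\<lambda>x. F2add x z"]) 
        (use z assms in \<open>auto simp: F2add_closed F2add_cancel subset_iff\<close>)
    then show "real (card {u\<in>F2vec t. F2add u z \<in> B}) = real (card B)"
      by (simp add: bij_betw_same_card)
  qed simp
  finally show ?thesis by simp
qed

text \<open>The left side is the diagonal of the expanded product.\<close>

lemma sum_mult_le_sum_mult_sum:
  fixes f g :: "'a \<Rightarrow> real"
  assumes "finite A" "\<And>x. x \<in> A \<Longrightarrow> 0 \<le> f x" "\<And>x. x \<in> A \<Longrightarrow> 0 \<le> g x"
  shows "(\<Sum>x\<in>A. f x * g x) \<le> (\<Sum>x\<in>A. f x) * (\<Sum>x\<in>A. g x)"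
  unfolding sum_distrib_right
  by (intro sum_mono mult_left_mono member_le_sum) (use assms in auto)

text \<open>Cauchy-Schwarz against the constant 1, which is Jensen's inequality for the
  root.\<close>

lemma sum_sqrt_le:
  fixes f :: "'a \<Rightarrow> real"
  assumes "\<And>x. x \<in> A \<Longrightarrow> 0 \<le> f x"
  shows "(\<Sum>x\<in>A. sqrt (f x)) \<le> sqrt (card A * (\<Sum>x\<in>A. f x))"
proof (rule real_le_rsqrt)
  have "(\<Sum>x\<in>A. sqrt (f x))\<^sup>2 \<le> (\<Sum>x\<in>A. (sqrt (f x))\<^sup>2) * card A"
    by (rule sum_squared_le_sum_of_squares)
  also have "(\<Sum>x\<in>A. (sqrt (f x))\<^sup>2) = (\<Sum>x\<in>A. f x)"
    by (rule sum.cong) (auto simp: assms)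
  finally show "(\<Sum>x\<in>A. sqrt (f x))\<^sup>2 \<le> card A * (\<Sum>x\<in>A. f x)"
    by (simp add: mult.commute)
qed

text \<open>Exposing the first column: over \<open>True # s\<close> the coset has the point over
  \<open>False # s\<close> moved by u. So the two slices may be merged into one, with the remaining
  columns deciding.\<close>

lemma covered_Cons:
  assumes "u \<in> F2vec t" "us \<in> tuples t k"
  shows "covered t C (u # us) \<longleftrightarrow>
    covered t (\<lambda>s. {z \<in> C (False # s). F2add u z \<in> C (True # s)}) us"
proof -
  have len: "length us = k" "length (u # us) = Suc k" using assms by (simp_all add: tuples_def)
  have split: "(\<forall>s\<in>F2vec (Suc k). Q s) \<longleftrightarrow> (\<forall>s\<in>F2vec k. Q (False # s) \<and> Q (True # s))" for Q
  proof -
    have "F2vec (Suc k) = Cons False ` F2vec k \<union> Cons True ` F2vec k"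
      by (rule F2vec_Suc)
    then show ?thesis by auto
  qed
  show ?thesis
    unfolding covered_def len split
  proof (rule bex_cong[OF refl])
    fix y assume y: "y \<in> F2vec t"
    have "F2add y (F2add u (comb t us s)) = F2add u (F2add y (comb t us s))" for s
      by (rule F2add_left_commute[OF y assms(1) comb_closed[OF assms(2)]])
    then show "(\<forall>s\<in>F2vec k. F2add y (comb t (u # us) (False # s)) \<in> C (False # s) \<and>
          F2add y (comb t (u # us) (True # s)) \<in> C (True # s)) \<longleftrightarrow>
        (\<forall>s\<in>F2vec k. F2add y (comb t us s) \<in> {z \<in> C (False # s). F2add u z \<in> C (True # s)})"
      by simp
  qed
qed

text \<open>In the induction step the bound A T on the probability, being also at most 1, is replaced by
  sqrt (A T), so that Jensen's inequality applies; the squaring of T on average then undoes the root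
  of T, and only A is replaced by its root.\<close>

lemma card_covered_le:
  assumes "\<And>s. s \<in> F2vec k \<Longrightarrow> C s \<subseteq> F2vec t"
  shows "real (card {us \<in> tuples t k. covered t C us})
    \<le> 2 powr (t / 2 ^ k) * (\<Sum>s\<in>F2vec k. real (card (C s))) / 2 ^ t * (2 ^ t) ^ k"
  using assms
proof (induction k arbitrary: C)
  case 0
  then have C: "C [] \<subseteq> F2vec t" by (simp add: F2vec_0)
  have fin: "finite (C [])" using C finite_F2vec finite_subset by blast
  \<comment> \<open>Without columns the factor is 2 powr t / 2 ^ t = 1, and the only tuple,
    \<open>[]\<close>, is covered only if \<open>C []\<close> has an element.\<close>
  have "card {us \<in> tuples t 0. covered t C us} \<le> card (C [])"
  proof (cases "C [] = {}")
    case True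
    then have "{us \<in> tuples t 0. covered t C us} = {}"
      by (auto simp: tuples_def covered_def F2vec_0)
    then show ?thesis by (simp only: card.empty)
  next
    case False
    then have "1 \<le> card (C [])" using fin by (simp add: Suc_le_eq card_gt_0_iff)
    moreover have "card {us \<in> tuples t 0. covered t C us} \<le> card {[] :: bool list list}"
      by (rule card_mono) (auto simp: tuples_def)
    ultimately show ?thesis by simp
  qed
  then show ?case by (simp add: F2vec_0 powr_realpow)
next
  case (Suc k)
  let ?q = "2 ^ t :: real" and ?A = "2 powr (t / 2 ^ k)"
  define C' where "C' u s = {z \<in> C (False # s). F2add u z \<in> C (True # s)}" for u s
  define T where "T u = (\<Sum>s\<in>F2vec k. real (card (C' u s)))" for u
  define N where "N u = real (card {us \<in> tuples t k. covered t (C' u) us})" for u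
  have sub: "C (c # s) \<subseteq> F2vec t" if "s \<in> F2vec k" for c s
    using that Suc.prems by (simp add: F2vec_def)
  have T0: "T u \<ge> 0" for u by (simp add: T_def sum_nonneg)
  have N: "N u \<le> ?q ^ k * sqrt (?A * T u / ?q)" for u
  proof -
    have "N u \<le> ?A * T u / ?q * ?q ^ k"
      unfolding N_def T_def by (rule Suc.IH) (use sub in \<open>auto simp: C'_def\<close>)
    moreover have "N u \<le> ?q ^ k"
    proof -
      have "card {us \<in> tuples t k. covered t (C' u) us} \<le> card (tuples t k)"
        by (rule card_mono) (auto simp: finite_tuples)
      then show ?thesis unfolding N_def card_tuples by (metis of_nat_le_iff of_nat_numeral of_nat_power)
    qed
    moreover have "0 \<le> N u" by (simp add: N_def)
    ultimately have "N u * N u \<le> (?A * T u / ?q * ?q ^ k) * ?q ^ k"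
      by (intro mult_mono) auto
    then have "N u \<le> sqrt ((?A * T u / ?q) * (?q ^ k)\<^sup>2)"
      by (intro real_le_rsqrt) (simp add: power2_eq_square)
    also have "\<dots> = ?q ^ k * sqrt (?A * T u / ?q)"
      unfolding real_sqrt_mult by simp
    finally show ?thesis .
  qed
  have "{us \<in> tuples t (Suc k). covered t C us}
      = (\<lambda>(u, us). u # us) ` (SIGMA u:F2vec t. {us \<in> tuples t k. covered t (C' u) us})"
  proof -
    have "{us \<in> tuples t (Suc k). covered t C us}
        = (\<lambda>(u, us). u # us) ` (SIGMA u:F2vec t. {us \<in> tuples t k. covered t C (u # us)})"
      by (auto simp: tuples_def length_Suc_conv image_iff)
    also have "(SIGMA u:F2vec t. {us \<in> tuples t k. covered t C (u # us)})
        = (SIGMA u:F2vec t. {us \<in> tuples t k. covered t (C' u) us})"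
      unfolding C'_def using covered_Cons by (intro Sigma_cong Collect_cong) blast+
    finally show ?thesis .
  qed
  then have "card {us \<in> tuples t (Suc k). covered t C us}
      = card (SIGMA u:F2vec t. {us \<in> tuples t k. covered t (C' u) us})"
    by (simp add: card_image inj_on_def split_def prod_eq_iff)
  then have "real (card {us \<in> tuples t (Suc k). covered t C us}) = (\<Sum>u\<in>F2vec t. N u)"
    by (simp add: card_SigmaI finite_F2vec finite_tuples N_def)
  also have "\<dots> \<le> (\<Sum>u\<in>F2vec t. ?q ^ k * sqrt (?A * T u / ?q))"
    by (rule sum_mono) (rule N)
  also have "\<dots> = ?q ^ k * (\<Sum>u\<in>F2vec t. sqrt (?A * T u / ?q))"
    by (simp add: sum_distrib_left)
  also have "\<dots> \<le> ?q ^ k * sqrt (card (F2vec t) * (\<Sum>u\<in>F2vec t. ?A * T u / ?q))"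
    by (intro mult_left_mono sum_sqrt_le) (auto simp: T0)
  also have "card (F2vec t) * (\<Sum>u\<in>F2vec t. ?A * T u / ?q) = ?A * (\<Sum>u\<in>F2vec t. T u)"
    by (simp add: card_F2vec sum_distrib_left[symmetric] sum_divide_distrib[symmetric])
  also have "(\<Sum>u\<in>F2vec t. T u)
      = (\<Sum>s\<in>F2vec k. real (card (C (False # s))) * real (card (C (True # s))))"
  proof -
    have "(\<Sum>u\<in>F2vec t. T u) = (\<Sum>s\<in>F2vec k. \<Sum>u\<in>F2vec t. real (card (C' u s)))"
      unfolding T_def by (rule sum.swap)
    also have "\<dots> = (\<Sum>s\<in>F2vec k. real (card (C (False # s))) * real (card (C (True # s))))"
      unfolding C'_def by (intro sum.cong sum_card_translates sub refl)
    finally show ?thesis .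
  qed
  also have "?q ^ k * sqrt (?A * \<dots>) \<le> ?q ^ k * sqrt (?A * (\<Sum>s\<in>F2vec (Suc k). real (card (C s)))\<^sup>2)"
  proof (intro mult_left_mono real_sqrt_le_mono)
    let ?f = "\<lambda>c. \<Sum>s\<in>F2vec k. real (card (C (c # s)))"
    have "(\<Sum>s\<in>F2vec k. real (card (C (False # s))) * real (card (C (True # s)))) \<le> ?f False * ?f True"
      by (rule sum_mult_le_sum_mult_sum) (auto simp: finite_F2vec)
    \<comment> \<open>A crude bound that gives up a factor of 4 but leaves the total over all
      slices.\<close>
    also have "\<dots> \<le> (?f False + ?f True) * (?f False + ?f True)"
      by (intro mult_mono) (auto simp: sum_nonneg add_nonneg_nonneg)
    finally show "(\<Sum>s\<in>F2vec k. real (card (C (False # s))) * real (card (C (True # s))))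
        \<le> (\<Sum>s\<in>F2vec (Suc k). real (card (C s)))\<^sup>2"
      by (simp add: sum_F2vec_Suc sum.distrib power2_eq_square)
  qed auto
  also have "\<dots> = ?q ^ k * (2 powr (t / 2 ^ Suc k) * (\<Sum>s\<in>F2vec (Suc k). real (card (C s))))"
  proof -
    \<comment> \<open>The root halves the exponent, which accounts for its form t / 2 ^ k.\<close>
    have "sqrt ?A = 2 powr (t / 2 ^ Suc k)"
      by (simp add: powr_half_sqrt[symmetric] powr_powr mult.commute)
    then show ?thesis by (simp add: real_sqrt_mult sum_nonneg)
  qed
  also have "\<dots> = 2 powr (t / 2 ^ Suc k) * (\<Sum>s\<in>F2vec (Suc k). real (card (C s))) / ?q * ?q ^ Suc k"
    by simp
  finally show ?case .
qed


section \<open>Deviating cells of a pair of maps\<close>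

text \<open>The slice at s of the set of deviating cells, in the format that \<open>covered\<close>
  expects. It takes P itself as argument, so it does not depend on the matrix U through which P
  arises.\<close>

definition deviant :: "bool list set \<Rightarrow> nat \<Rightarrow> real \<Rightarrow> real \<Rightarrow> (bool list \<Rightarrow> bool list) \<Rightarrow>
    (bool list \<Rightarrow> bool list) \<Rightarrow> bool list \<Rightarrow> bool list set" where
  "deviant S t \<nu> \<epsilon> P r s = {z \<in> F2vec t. \<epsilon> \<le> \<bar>real (card {x\<in>S. P x = z \<and> r x = s}) - \<nu>\<bar>}"

lemma sum_sum_Times:
  "(\<Sum>x\<in>A. \<Sum>y\<in>B. f x y) = (\<Sum>i\<in>A \<times> B. f (fst i) (snd i))"
  by (simp add: sum.cartesian_product split_def)

text \<open>Chebyshev's inequality for the joint map x -> (P x, r x). The collision probabilities of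
  the two independent maps multiply, so \<open>second_moment\<close> applies with range F_2^t x
  F_2^b.\<close>

lemma sum_card_deviant_le:
  assumes S: "S \<subseteq> F2vec n" and \<epsilon>: "0 \<le> \<epsilon>"
    and \<nu>: "\<nu> = card S / (2 ^ t * 2 ^ b)"
  shows "(\<Sum>P\<in>lin_maps n t. \<Sum>r\<in>lin_maps n b. \<Sum>s\<in>F2vec b. real (card (deviant S t \<nu> \<epsilon> P r s))) * \<epsilon>\<^sup>2
    \<le> real (card (lin_maps n t)) * card (lin_maps n b) * card S"
proof -
  let ?H = "lin_maps n t \<times> lin_maps n b" and ?Z = "F2vec t \<times> F2vec b"
  let ?h = "\<lambda>i x. (fst i x, snd i x) :: bool list \<times> bool list"
  have Z: "real (card ?Z) = 2 ^ t * 2 ^ b" by (simp add: card_cartesian_product card_F2vec)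
  have "(\<Sum>i\<in>?H. \<Sum>z\<in>?Z. (real (card {x\<in>S. ?h i x = z}) - card S / card ?Z)\<^sup>2)
      \<le> real (card ?H) * card S"
  proof (rule second_moment)
    show "finite ?H" "finite S" "finite ?Z"
      using S finite_F2vec finite_subset by (auto simp: finite_lin_maps)
    show "?h i x \<in> ?Z" if "i \<in> ?H" "x \<in> S" for i x
      using that S by (auto simp: mem_Times_iff subset_iff intro: lin_maps_mem)
    fix x y assume xy: "x \<in> S" "y \<in> S" "x \<noteq> y"
    have "{i \<in> ?H. ?h i x = ?h i y}
        = {L \<in> lin_maps n t. L x = L y} \<times> {L \<in> lin_maps n b. L x = L y}"
      by auto
    then have "card {i \<in> ?H. ?h i x = ?h i y} * card ?Z
        = (card {L \<in> lin_maps n t. L x = L y} * 2 ^ t) * (card {L \<in> lin_maps n b. L x = L y} * 2 ^ b)"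
      by (simp add: card_cartesian_product card_F2vec)
    also have "\<dots> = card ?H"
      using xy S by (subst (1 2) lin_maps_universal) (auto simp: card_cartesian_product)
    finally show "card {i \<in> ?H. ?h i x = ?h i y} * card ?Z = card ?H" .
  qed
  note total = this
  have dev: "(\<Sum>s\<in>F2vec b. real (card (deviant S t \<nu> \<epsilon> P r s))) * \<epsilon>\<^sup>2
      \<le> (\<Sum>z\<in>?Z. (real (card {x\<in>S. (P x, r x) = z}) - card S / card ?Z)\<^sup>2)" for P r
  proof -
    have "(\<Sum>s\<in>F2vec b. real (card (deviant S t \<nu> \<epsilon> P r s))) * \<epsilon>\<^sup>2
        = (\<Sum>s\<in>F2vec b. \<Sum>z\<in>deviant S t \<nu> \<epsilon> P r s. \<epsilon>\<^sup>2)"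
      by (simp add: sum_distrib_right)
    also have "\<dots> \<le> (\<Sum>s\<in>F2vec b. \<Sum>z\<in>F2vec t. (real (card {x\<in>S. P x = z \<and> r x = s}) - \<nu>)\<^sup>2)"
    proof (rule sum_mono)
      fix s
      have "(\<Sum>z\<in>deviant S t \<nu> \<epsilon> P r s. \<epsilon>\<^sup>2)
          \<le> (\<Sum>z\<in>deviant S t \<nu> \<epsilon> P r s. (real (card {x\<in>S. P x = z \<and> r x = s}) - \<nu>)\<^sup>2)"
      proof (rule sum_mono)
        fix z assume "z \<in> deviant S t \<nu> \<epsilon> P r s"
        then show "\<epsilon>\<^sup>2 \<le> (real (card {x\<in>S. P x = z \<and> r x = s}) - \<nu>)\<^sup>2"
          using \<epsilon> by (simp add: deviant_def abs_le_square_iff[symmetric])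
      qed
      also have "\<dots> \<le> (\<Sum>z\<in>F2vec t. (real (card {x\<in>S. P x = z \<and> r x = s}) - \<nu>)\<^sup>2)"
        by (rule sum_mono2) (auto simp: finite_F2vec deviant_def)
      finally show "(\<Sum>z\<in>deviant S t \<nu> \<epsilon> P r s. \<epsilon>\<^sup>2)
          \<le> (\<Sum>z\<in>F2vec t. (real (card {x\<in>S. P x = z \<and> r x = s}) - \<nu>)\<^sup>2)" .
    qed
    also have "\<dots> = (\<Sum>z\<in>F2vec t. \<Sum>s\<in>F2vec b. (real (card {x\<in>S. P x = z \<and> r x = s}) - \<nu>)\<^sup>2)"
      by (rule sum.swap)
    finally show ?thesis
      unfolding Z \<nu> sum_sum_Times by (simp add: prod_eq_iff)
  qed
  have "(\<Sum>P\<in>lin_maps n t. \<Sum>r\<in>lin_maps n b. \<Sum>s\<in>F2vec b. real (card (deviant S t \<nu> \<epsilon> P r s))) * \<epsilon>\<^sup>2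
      = (\<Sum>i\<in>?H. (\<Sum>s\<in>F2vec b. real (card (deviant S t \<nu> \<epsilon> (fst i) (snd i) s))) * \<epsilon>\<^sup>2)"
    by (simp only: sum_sum_Times[of _ "lin_maps n b"] sum_distrib_right)
  also have "\<dots> \<le> (\<Sum>i\<in>?H. \<Sum>z\<in>?Z. (real (card {x\<in>S. ?h i x = z}) - card S / card ?Z)\<^sup>2)"
    by (intro sum_mono dev)
  also note total
  finally show ?thesis by (simp add: card_cartesian_product)
qed

text \<open>Given L, a random r cuts the deviating fibre F into 2^b pieces, which are the cells of
  (P, r) on the coset of (y, 0). If the coset is not covered, some piece is far from the average
  piece, and by the second moment this happens for at most half of all r.\<close>

lemma half_cover_deviant:
  assumes S: "S \<subseteq> F2vec n" and L: "L \<in> lin_maps n t" and us: "us \<in> tuples t b"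
    and y: "y \<in> F2vec t" and \<mu>: "\<mu> = card S / 2 ^ t" "0 < \<mu>"
    and dev: "\<tau> * \<mu> < \<bar>real (card {x\<in>S. L x = y}) - \<mu>\<bar>"
    and \<tau>: "0 < \<tau>" "\<tau> < 1" and size: "16 * (2 ^ b)\<^sup>2 \<le> \<tau>\<^sup>2 * \<mu>"
  shows "real (card (lin_maps n b)) \<le> 2 * card {r \<in> lin_maps n b.
    covered t (deviant S t (\<mu> / 2 ^ b) (\<tau> / 2 * (\<mu> / 2 ^ b)) (shift_map n (\<lambda>x. comb t us (r x)) L) r) us}"
proof -
  let ?R = "lin_maps n b"
  define \<nu> where "\<nu> = \<mu> / 2 ^ b"
  define D where "D r = deviant S t \<nu> (\<tau> / 2 * \<nu>) (shift_map n (\<lambda>x. comb t us (r x)) L) r" for r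
  define F where "F = {x\<in>S. L x = y}"
  define \<phi> where "\<phi> = real (card F)"
  \<comment> \<open>How far the average piece of the fibre is from the mean cell size
    \<open>\<nu>\<close>.\<close>
  define d where "d = \<bar>\<phi> / 2 ^ b - \<nu>\<bar>"
  define g where "g r s = real (card {x\<in>F. r x = s})" for r :: "bool list \<Rightarrow> bool list" and s
  have F: "finite F" "F \<subseteq> F2vec n"
    using S finite_subset[OF S finite_F2vec] by (auto simp: F_def)
  have \<nu>: "0 < \<nu>" using \<mu>(2) by (simp add: \<nu>_def)
  have "d = \<bar>\<phi> - \<mu>\<bar> / 2 ^ b"
    by (simp add: d_def \<nu>_def diff_divide_distrib[symmetric] del: \<mu>)
  then have d: "\<tau> * \<nu> < d" and d_eq: "d * 2 ^ b = \<bar>\<phi> - \<mu>\<bar>"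
    using dev by (simp_all add: \<nu>_def \<phi>_def F_def divide_strict_right_mono)
  have dpos: "0 < d" using d \<nu> \<tau> by (meson less_trans mult_pos_pos)
  \<comment> \<open>Where r x = s, the translation adds U s to L x, so P x = y + U s says the same
    as L x = y.\<close>
  have load: "card {x\<in>S. shift_map n (\<lambda>x. comb t us (r x)) L x = F2add y (comb t us s) \<and> r x = s}
      = card {x\<in>F. r x = s}" for r s
  proof -
    have "shift_map n (\<lambda>x. comb t us (r x)) L x = F2add y (comb t us s) \<longleftrightarrow> L x = y"
      if "x \<in> S" "r x = s" for x
    proof -
      have x: "x \<in> F2vec n" using that S by auto
      show ?thesis
        using that F2add_right_eq_iff[OF lin_maps_mem[OF L x] y comb_closed[OF us]]
        by (simp add: shift_map_apply x)
    qed
    then show ?thesis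
      by (intro arg_cong[of _ _ card]) (auto simp: F_def)
  qed
  \<comment> \<open>Some piece is within \<open>\<tau>\<close> \<open>\<nu>\<close> / 2 < d / 2 of
    \<open>\<nu>\<close>, hence at least d / 2 away from the average piece.\<close>
  have unc: "d\<^sup>2 / 4 \<le> (\<Sum>s\<in>F2vec b. (g r s - \<phi> / 2 ^ b)\<^sup>2)"
    if "r \<in> ?R" and nc: "\<not> covered t (D r) us" for r
  proof -
    obtain s where s: "s \<in> F2vec b" and "F2add y (comb t us s) \<notin> D r s"
      using nc y us by (auto simp: covered_def tuples_def)
    then have "\<bar>g r s - \<nu>\<bar> < \<tau> / 2 * \<nu>"
      using F2add_closed[OF y comb_closed[OF us]] by (auto simp: D_def deviant_def g_def load)
    then have "\<bar>g r s - \<nu>\<bar> < (\<tau> * \<nu>) / 2" by simp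
    moreover have "d \<le> \<bar>g r s - \<phi> / 2 ^ b\<bar> + \<bar>g r s - \<nu>\<bar>" unfolding d_def by linarith
    ultimately have "\<bar>d / 2\<bar> \<le> \<bar>g r s - \<phi> / 2 ^ b\<bar>"
      using d dpos by linarith
    then have "(d / 2)\<^sup>2 \<le> (g r s - \<phi> / 2 ^ b)\<^sup>2"
      by (simp only: abs_le_square_iff)
    also have "\<dots> \<le> (\<Sum>s\<in>F2vec b. (g r s - \<phi> / 2 ^ b)\<^sup>2)"
      by (rule member_le_sum) (auto simp: s finite_F2vec)
    finally show ?thesis by (simp add: power_divide)
  qed
  let ?N = "{r \<in> ?R. \<not> covered t (D r) us}"
  have "card ?N * (d\<^sup>2 / 4) \<le> (\<Sum>r\<in>?N. \<Sum>s\<in>F2vec b. (g r s - \<phi> / 2 ^ b)\<^sup>2)"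
    by (rule sum_bounded_below) (use unc in auto)
  also have "\<dots> \<le> (\<Sum>r\<in>?R. \<Sum>s\<in>F2vec b. (g r s - \<phi> / 2 ^ b)\<^sup>2)"
    by (rule sum_mono2) (auto simp: finite_lin_maps sum_nonneg)
  also have "\<dots> \<le> card ?R * \<phi>"
    using second_moment[of ?R F "F2vec b" "\<lambda>r. r"] F lin_maps_universal[of _ n _ b]
    by (simp add: finite_lin_maps finite_F2vec card_F2vec g_def \<phi>_def subset_iff lin_maps_mem)
  \<comment> \<open>From \<open>\<phi>\<close> <= \<open>\<mu>\<close> + d 2^b and
    \<open>\<tau>\<close> \<open>\<mu>\<close> <= d 2^b follows \<open>\<tau>\<close>
    \<open>\<phi>\<close> <= 2 d 2^b. Since \<open>size\<close> gives 16 2^b <=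
    \<open>\<tau>\<close> d, the two combine to 8 \<open>\<phi>\<close> <= d^2.\<close>
  also have "\<dots> \<le> card ?R * (d\<^sup>2 / 8)"
  proof (rule mult_left_mono)
    have "\<phi> \<le> \<mu> + d * 2 ^ b" using d_eq by linarith
    moreover have "\<tau> * \<mu> \<le> d * 2 ^ b"
      using d by (simp add: \<nu>_def field_simps)
    moreover have "\<tau> * (d * 2 ^ b) \<le> d * 2 ^ b"
      using \<tau> dpos by (intro mult_left_le_one_le) auto
    moreover have "\<tau> * \<phi> \<le> \<tau> * (\<mu> + d * 2 ^ b)"
      using calculation(1) \<tau> by (intro mult_left_mono) auto
    ultimately have 1: "\<tau> * \<phi> \<le> 2 * (d * 2 ^ b)"
      by (simp add: distrib_left)
    have "16 * (2 ^ b)\<^sup>2 \<le> \<tau> * (\<tau> * \<mu>)"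
      using size by (simp add: power2_eq_square mult.assoc)
    also have "\<dots> \<le> \<tau> * (d * 2 ^ b)"
      using \<open>\<tau> * \<mu> \<le> d * 2 ^ b\<close> \<tau> by (intro mult_left_mono) auto
    finally have "(16 * 2 ^ b) * 2 ^ b \<le> (\<tau> * d) * 2 ^ b"
      by (simp add: power2_eq_square mult.assoc)
    then have 2: "16 * 2 ^ b \<le> \<tau> * d"
      by simp
    have "\<tau> * (8 * \<phi>) \<le> d * (16 * 2 ^ b)" using 1 by (simp add: mult_ac)
    also have "\<dots> \<le> d * (\<tau> * d)" using 2 dpos by (intro mult_left_mono) auto
    finally have "\<tau> * (8 * \<phi>) \<le> \<tau> * d\<^sup>2" by (simp add: power2_eq_square mult_ac)
    then show "\<phi> \<le> d\<^sup>2 / 8" using \<tau> by simp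
  qed simp
  finally have "(2 * card ?N) * (d\<^sup>2 / 8) \<le> card ?R * (d\<^sup>2 / 8)" by simp
  then have "2 * card ?N \<le> card ?R"
    using dpos by (simp add: mult_le_cancel_right of_nat_le_iff[symmetric, where 'a = real] del: of_nat_le_iff)
  moreover have "card ?R = card ?N + card {r \<in> ?R. covered t (D r) us}"
    by (subst card_Un_disjoint[symmetric]) (auto simp: finite_lin_maps intro: arg_cong[of _ _ card])
  ultimately have "card ?R \<le> 2 * card {r \<in> ?R. covered t (D r) us}" by linarith
  then show ?thesis by (simp add: D_def \<nu>_def of_nat_le_iff[symmetric, where 'a = real] del: of_nat_le_iff)
qed


section \<open>The proportion of maps with a deviating fibre\<close>

text \<open>The triples (L, U, r) with a covered coset are counted twice. From below, each bad L and
  each U admit half of all r. From above, L is replaced by P = L + U r, after which U varies freely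
  against a fixed sparse set.\<close>

lemma bad_lin_maps_le:
  assumes S: "S \<subseteq> F2vec n" and \<mu>: "\<mu> = card S / 2 ^ t" "0 < \<mu>"
    and \<tau>: "0 < \<tau>" "\<tau> < 1" and size: "16 * (2 ^ b)\<^sup>2 \<le> \<tau>\<^sup>2 * \<mu>" and tb: "t \<le> 2 ^ b"
  shows "real (card {L \<in> lin_maps n t. \<exists>y\<in>F2vec t. \<tau> * \<mu> < \<bar>real (card {x\<in>S. L x = y}) - \<mu>\<bar>}) * (\<tau>\<^sup>2 * \<mu>)
    \<le> 16 * (2 ^ b)\<^sup>2 * real (card (lin_maps n t))"
proof -
  let ?\<Lambda> = "lin_maps n t" and ?R = "lin_maps n b" and ?U = "tuples t b"
  define \<nu> where "\<nu> = \<mu> / 2 ^ b"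
  define \<epsilon> where "\<epsilon> = \<tau> / 2 * \<nu>"
  define C where "C = deviant S t \<nu> \<epsilon>"
  define sh where "sh us r = shift_map n (\<lambda>x. comb t us (r x))" for us r
  define B where "B = {L \<in> ?\<Lambda>. \<exists>y\<in>F2vec t. \<tau> * \<mu> < \<bar>real (card {x\<in>S. L x = y}) - \<mu>\<bar>}"
  define T where "T = (\<Sum>P\<in>?\<Lambda>. \<Sum>r\<in>?R. \<Sum>s\<in>F2vec b. real (card (C P r s)))"
  have R: "0 < real (card ?R)"
    using finite_lin_maps lin_maps_nonempty by (simp add: card_gt_0_iff)
  have half: "real (card ?R) \<le> 2 * real (card {r\<in>?R. covered t (C (sh us r L) r) us})"
    if "L \<in> B" "us \<in> ?U" for L us
    using that half_cover_deviant[OF S _ _ _ \<mu> _ \<tau> size] by (auto simp: B_def C_def sh_def \<nu>_def \<epsilon>_def)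
  \<comment> \<open>For fixed U and r the passage from L to P permutes \<open>lin_maps n t\<close>,
    so P is uniform and independent of U and r.\<close>
  have shift: "real (card {L\<in>?\<Lambda>. covered t (C (sh us r L) r) us})
      = card {P\<in>?\<Lambda>. covered t (C P r) us}" if "r \<in> ?R" "us \<in> ?U" for r us
  proof -
    have "bij_betw (sh us r) ?\<Lambda> ?\<Lambda>"
      unfolding sh_def
    proof (rule bij_betw_shift_map)
      show "(\<lambda>x. comb t us (r x)) \<in> F2vec n \<rightarrow> F2vec t"
        using comb_closed[OF that(2)] by blast
      show "additive_on n (\<lambda>x. comb t us (r x))"
        using additive_comb[OF that(2)] that(1) by (simp add: additive_on_def lin_maps_add lin_maps_mem)
    qed
    then have "bij_betw (sh us r) {L\<in>?\<Lambda>. covered t (C (sh us r L) r) us} {P\<in>?\<Lambda>. covered t (C P r) us}"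
      by (auto simp: bij_betw_def inj_on_def image_iff)
    then show ?thesis by (simp add: bij_betw_same_card)
  qed
  \<comment> \<open>By \<open>t \<le> 2 ^ b\<close> there are enough columns to bring the factor 2
    powr (t / 2 ^ b) down to 2.\<close>
  have cov: "real (card {us\<in>?U. covered t (C P r) us})
      \<le> 2 * (\<Sum>s\<in>F2vec b. real (card (C P r s))) / 2 ^ t * (2 ^ t) ^ b" for P r
  proof -
    have "real t \<le> 2 ^ b" using tb by (metis of_nat_le_iff of_nat_numeral of_nat_power)
    then have "2 powr (t / 2 ^ b) \<le> (2::real) powr 1"
      by (intro powr_mono) auto
    then have "2 powr (t / 2 ^ b) * (\<Sum>s\<in>F2vec b. real (card (C P r s))) / 2 ^ t * (2 ^ t) ^ b
        \<le> 2 * (\<Sum>s\<in>F2vec b. real (card (C P r s))) / 2 ^ t * (2 ^ t) ^ b"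
      by (intro mult_right_mono divide_right_mono) (auto simp: sum_nonneg)
    moreover have "real (card {us\<in>?U. covered t (C P r) us})
        \<le> 2 powr (t / 2 ^ b) * (\<Sum>s\<in>F2vec b. real (card (C P r s))) / 2 ^ t * (2 ^ t) ^ b"
      by (rule card_covered_le) (auto simp: C_def deviant_def)
    ultimately show ?thesis by linarith
  qed
  have "card B * ((2 ^ t) ^ b * card ?R) = (\<Sum>L\<in>B. \<Sum>us\<in>?U. real (card ?R))"
    by (simp add: card_tuples)
  also have "\<dots> \<le> (\<Sum>L\<in>B. \<Sum>us\<in>?U. 2 * real (card {r\<in>?R. covered t (C (sh us r L) r) us}))"
    by (intro sum_mono half)
  also have "\<dots> \<le> (\<Sum>L\<in>?\<Lambda>. \<Sum>us\<in>?U. 2 * real (card {r\<in>?R. covered t (C (sh us r L) r) us}))"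
    by (rule order_trans[OF _ sum_mono2]) (auto simp: finite_lin_maps B_def sum_nonneg)
  also have "\<dots> = 2 * (\<Sum>us\<in>?U. \<Sum>L\<in>?\<Lambda>. real (card {r\<in>?R. covered t (C (sh us r L) r) us}))"
    unfolding sum.swap[of _ ?\<Lambda> ?U] by (simp add: sum_distrib_left)
  also have "\<dots> = 2 * (\<Sum>us\<in>?U. \<Sum>r\<in>?R. real (card {L\<in>?\<Lambda>. covered t (C (sh us r L) r) us}))"
    by (intro arg_cong[of _ _ "\<lambda>x. 2 * x"] sum.cong refl sum_card_filter_swap finite_lin_maps finite_tuples)
  also have "\<dots> = 2 * (\<Sum>us\<in>?U. \<Sum>r\<in>?R. real (card {P\<in>?\<Lambda>. covered t (C P r) us}))"
    by (simp add: shift)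
  also have "\<dots> = 2 * (\<Sum>r\<in>?R. \<Sum>us\<in>?U. real (card {P\<in>?\<Lambda>. covered t (C P r) us}))"
    by (subst sum.swap) (rule refl)
  also have "\<dots> = 2 * (\<Sum>r\<in>?R. \<Sum>P\<in>?\<Lambda>. real (card {us\<in>?U. covered t (C P r) us}))"
    by (intro arg_cong[of _ _ "\<lambda>x. 2 * x"] sum.cong refl sum_card_filter_swap finite_lin_maps finite_tuples)
  also have "\<dots> \<le> 2 * (\<Sum>r\<in>?R. \<Sum>P\<in>?\<Lambda>. 2 * (\<Sum>s\<in>F2vec b. real (card (C P r s))) / 2 ^ t * (2 ^ t) ^ b)"
    by (intro mult_left_mono sum_mono cov) simp
  \<comment> \<open>One factor 2 comes from \<open>half\<close>, the other from \<open>cov\<close>.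
    The 1/2 in \<open>\<epsilon>\<close>, once squared, will turn 4 into 16.\<close>
  also have "\<dots> = 4 * T / 2 ^ t * (2 ^ t) ^ b"
    unfolding T_def sum.swap[of _ ?\<Lambda> ?R]
    by (simp add: sum_distrib_left[symmetric] sum_distrib_right[symmetric] sum_divide_distrib[symmetric])
  finally have "real (card B * card ?R) * (2 ^ t) ^ b \<le> 4 * T / 2 ^ t * (2 ^ t) ^ b"
    by (simp only: mult_ac of_nat_mult of_nat_power of_nat_numeral)
  then have "card B * card ?R \<le> 4 * T / 2 ^ t"
    by (rule mult_right_le_imp_le) simp
  then have 1: "card B * card ?R * 2 ^ t \<le> 4 * T" by (simp add: field_simps)
  have \<epsilon>: "0 < \<epsilon>" using \<tau> \<mu>(2) by (simp add: \<epsilon>_def \<nu>_def)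
  have 2: "T * \<epsilon>\<^sup>2 \<le> card ?\<Lambda> * card ?R * card S"
    unfolding T_def C_def 
    by (rule order_trans[OF sum_card_deviant_le[OF S]]) (use \<epsilon> \<mu>(1) in \<open>auto simp: \<nu>_def\<close>)
  have "card B * card ?R * 2 ^ t * \<epsilon>\<^sup>2 \<le> 4 * (real (card ?\<Lambda>) * card ?R * card S)"
    using mult_right_mono[OF 1, of "\<epsilon>\<^sup>2"] 2 by simp
  also have "real (card S) = \<mu> * 2 ^ t" using \<mu>(1) by simp
  finally have "(card ?R * 2 ^ t) * (card B * \<epsilon>\<^sup>2) \<le> (card ?R * 2 ^ t) * (4 * card ?\<Lambda> * \<mu>)"
    by (simp add: mult_ac)
  then have "card B * \<epsilon>\<^sup>2 \<le> 4 * card ?\<Lambda> * \<mu>"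
    using R by simp
  moreover have "\<epsilon>\<^sup>2 = \<tau>\<^sup>2 * \<mu> * \<mu> / (4 * (2 ^ b)\<^sup>2)"
    by (simp add: \<epsilon>_def \<nu>_def power2_eq_square)
  ultimately have "\<mu> * (card B * (\<tau>\<^sup>2 * \<mu>)) \<le> \<mu> * (16 * (2 ^ b)\<^sup>2 * real (card ?\<Lambda>))"
    by (simp add: field_simps)
  then have "card B * (\<tau>\<^sup>2 * \<mu>) \<le> 16 * (2 ^ b)\<^sup>2 * real (card ?\<Lambda>)"
    using \<mu>(2) by simp
  then show ?thesis by (simp add: B_def)
qed

text \<open>As \<open>\<tau>\<close> < 1, a map without deviating fibres has no empty fibre and so
  is surjective. The good surjective maps thus make up a (1 - \<open>\<delta>\<close>)-fraction even
  of all linear maps.\<close>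

lemma close_unif_surj_fraction:
  assumes S: "S \<subseteq> F2vec n" and \<mu>: "\<mu> = card S / 2 ^ t" "0 < \<mu>"
    and \<tau>: "0 < \<tau>" "\<tau> < 1" and \<delta>: "0 < \<delta>" "\<delta> < 1"
    and size: "16 * (2 ^ b)\<^sup>2 \<le> \<delta> * (\<tau>\<^sup>2 * \<mu>)" and tb: "t \<le> 2 ^ b"
  shows "real (card {L \<in> surj_lin_maps n t.
      close_unif_linf (prob_image_unif L S) (F2vec t) (\<tau> * 2 powr (- real t))})
    \<ge> (1 - \<delta>) * real (card (surj_lin_maps n t))"
proof -
  let ?\<Lambda> = "lin_maps n t"
  define B where "B = {L \<in> ?\<Lambda>. \<exists>y\<in>F2vec t. \<tau> * \<mu> < \<bar>real (card {x\<in>S. L x = y}) - \<mu>\<bar>}"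
  define G where "G = {L \<in> surj_lin_maps n t.
      close_unif_linf (prob_image_unif L S) (F2vec t) (\<tau> * 2 powr (- real t))}"
  have pos: "0 < \<tau>\<^sup>2 * \<mu>" using \<tau> \<mu>(2) by simp
  have "16 * (2 ^ b)\<^sup>2 \<le> \<tau>\<^sup>2 * \<mu>"
    using size mult_right_mono[of \<delta> 1 "\<tau>\<^sup>2 * \<mu>"] pos \<delta> by linarith
  from bad_lin_maps_le[OF S \<mu> \<tau> this tb]
  have "card B * (\<tau>\<^sup>2 * \<mu>) \<le> 16 * (2 ^ b)\<^sup>2 * real (card ?\<Lambda>)" by (simp add: B_def)
  also have "\<dots> \<le> \<delta> * (\<tau>\<^sup>2 * \<mu>) * card ?\<Lambda>"
    using size by (rule mult_right_mono) simp
  finally have "(\<tau>\<^sup>2 * \<mu>) * card B \<le> (\<tau>\<^sup>2 * \<mu>) * (\<delta> * card ?\<Lambda>)" by (simp add: mult_ac)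
  then have bad: "card B \<le> \<delta> * card ?\<Lambda>" using pos by (simp only: mult_le_cancel_left_pos)
  have surj_sub: "surj_lin_maps n t \<subseteq> ?\<Lambda>"
    by (auto simp: surj_lin_maps_def lin_maps_def additive_on_def)
  have "?\<Lambda> - B \<subseteq> G"
  proof
    fix L assume "L \<in> ?\<Lambda> - B"
    then have L: "L \<in> ?\<Lambda>" and good: "\<bar>real (card {x\<in>S. L x = y}) - \<mu>\<bar> \<le> \<tau> * \<mu>" if "y \<in> F2vec t" for y
      using that by (auto simp: B_def not_less)
    have "y \<in> L ` F2vec n" if "y \<in> F2vec t" for y
    proof -
      have "(1 - \<tau>) * \<mu> \<le> real (card {x\<in>S. L x = y})"
        using good[OF that] by (simp add: algebra_simps abs_le_iff)
      moreover have "0 < (1 - \<tau>) * \<mu>" using \<tau> \<mu>(2) by simp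
      ultimately have "{x\<in>S. L x = y} \<noteq> {}" by (metis card.empty less_le_not_le of_nat_0)
      then show ?thesis using S by blast
    qed
    then have "L \<in> surj_lin_maps n t"
      using \<open>L \<in> ?\<Lambda> - B\<close> lin_maps_mem by (auto simp: surj_lin_maps_def lin_maps_def additive_on_def)
    moreover have "close_unif_linf (prob_image_unif L S) (F2vec t) (\<tau> * 2 powr (- real t))"
      unfolding close_unif_linf_def
    proof
      fix y assume y: "y \<in> F2vec t"
      have cS: "real (card S) = \<mu> * 2 ^ t" using \<mu>(1) by simp
      have "prob_image_unif L S y - 1 / real (card (F2vec t))
          = (real (card {x\<in>S. L x = y}) - \<mu>) / (\<mu> * 2 ^ t)"
        using \<mu>(2) by (simp add: prob_image_unif_def cS card_F2vec diff_divide_distrib)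
      then have "\<bar>prob_image_unif L S y - 1 / real (card (F2vec t))\<bar>
          = \<bar>real (card {x\<in>S. L x = y}) - \<mu>\<bar> / (\<mu> * 2 ^ t)"
        using \<mu>(2) by simp
      also have "\<dots> \<le> \<tau> * \<mu> / (\<mu> * 2 ^ t)"
        using good[OF y] \<mu>(2) by (intro divide_right_mono) auto
      also have "\<dots> = \<tau> * 2 powr (- real t)"
        using \<mu>(2) by (simp add: powr_minus powr_realpow divide_inverse)
      finally show "\<bar>prob_image_unif L S y - 1 / real (card (F2vec t))\<bar> \<le> \<tau> * 2 powr (- real t)" .
    qed
    ultimately show "L \<in> G" by (simp add: G_def)
  qed
  moreover have "finite G" "finite B"
    using surj_sub finite_lin_maps[of n t] by (auto simp: G_def B_def intro: finite_subset)
  moreover have "card ?\<Lambda> - card B \<le> card (?\<Lambda> - B)"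
    using \<open>finite B\<close> by (rule diff_card_le_card_Diff)
  ultimately have "card ?\<Lambda> - card B \<le> card G"
    using card_mono le_trans by blast
  then have "real (card ?\<Lambda>) - card B \<le> card G" by linarith
  then have "(1 - \<delta>) * card ?\<Lambda> \<le> card G" using bad by (simp add: algebra_simps)
  moreover have "(1 - \<delta>) * card (surj_lin_maps n t) \<le> (1 - \<delta>) * card ?\<Lambda>"
    using \<delta> card_mono[OF finite_lin_maps surj_sub] by (intro mult_left_mono) auto
  ultimately show ?thesis by (simp add: G_def)
qed

section \<open>The choice of parameters\<close>

text \<open>Determines the number b of columns: 2^b must reach t for the covering bound, yet stay
  linear in t so that the cells remain large.\<close>

lemma ex_power2_between:
  assumes "0 < t"
  shows "\<exists>b. t \<le> 2 ^ b \<and> 2 ^ b < 2 * (t :: nat)"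
proof -
  define b where "b = (LEAST b. t \<le> 2 ^ b)"
  have "t \<le> 2 ^ t" by (simp add: less_imp_le)
  then have b: "t \<le> 2 ^ b" unfolding b_def by (rule LeastI)
  have "2 ^ b < 2 * t"
  proof (cases b)
    case (Suc b')
    then have "\<not> t \<le> 2 ^ b'" unfolding b_def by (intro not_less_Least) simp
    then show ?thesis by (simp add: Suc)
  qed (use assms in simp)
  with b show ?thesis by blast
qed

text \<open>The clause t <= n ensures that surjective maps exist, so the fraction is not taken of
  the empty set.\<close>

theorem mainTheorem4:
  fixes n :: nat and S :: "bool list set" and \<tau> \<delta> m :: real
  assumes S_sub: "S \<subseteq> F2vec n"
    and tau: "0 < \<tau>" "\<tau> < 1"
    and delta: "0 < \<delta>" "\<delta> < 1"
    and m_def: "m = log 2 (real (card S) * (real (card S) - 1) / \<delta>)"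
    and size: "real (card S) > 2 ^ 20 * m * max (2 ^ 8 * (1 + \<tau>) ^ 4 / (\<tau> * \<delta>) ^ 8) 1"
    and mbound: "m \<ge> 5 * log 2 (m * max (4 * (1 + \<tau>) / (\<tau> * \<delta>) ^ 2) 1) + 25"
  shows "\<exists>t::nat. real t \<ge> log 2 (real (card S))
              - 4 * log 2 (m * max (4 * (1 + \<tau>) / (\<tau> * \<delta>) ^ 2) 1) - 20
           \<and> t \<le> n
           \<and> real (card {L \<in> surj_lin_maps n t.
                  close_unif_linf (prob_image_unif L S) (F2vec t) (\<tau> * 2 powr (- real t))})
               \<ge> (1 - \<delta>) * real (card (surj_lin_maps n t))"
proof -
  define M where "M = max (4 * (1 + \<tau>) / (\<tau> * \<delta>) ^ 2) 1"
  define c where "c = real (card S)"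
  \<comment> \<open>Chosen so that log 2 K is exactly what the claim subtracts from log 2
    |S|.\<close>
  define K where "K = 2 ^ 20 * (m * M) ^ 4"
  \<comment> \<open>For |S| <= 1 the convention log 2 0 = 0 gives m = 0, and \<open>mbound\<close>
    would read 0 >= 25.\<close>
  have c2: "2 \<le> c"
  proof (rule ccontr)
    assume "\<not> 2 \<le> c"
    then have "card S = 0 \<or> card S = 1" by (auto simp: c_def)
    then have "m = 0" by (auto simp: m_def log_def)
    then show False using mbound by (simp add: log_def)
  qed
  have "c \<le> c * (c - 1) / \<delta>"
  proof -
    have "c * \<delta> \<le> c * (c - 1)" using c2 delta by (intro mult_left_mono) auto
    then show ?thesis using delta by (simp add: field_simps)
  qed
  then have cm: "log 2 c \<le> m" unfolding m_def c_def[symmetric] using c2 by simp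
  have "1 \<le> log 2 c" using c2 by simp
  then have m1: "1 \<le> m" using cm by simp
  have M1: "1 \<le> M" by (simp add: M_def)
  have MM: "4 \<le> M * (\<tau> * \<delta>)\<^sup>2"
  proof -
    have "4 / (\<tau> * \<delta>)\<^sup>2 \<le> 4 * (1 + \<tau>) / (\<tau> * \<delta>)\<^sup>2"
      using tau by (intro divide_right_mono) auto
    also have "\<dots> \<le> M" by (simp add: M_def)
    finally show ?thesis using tau delta by (simp add: divide_le_eq)
  qed
  have mM: "1 \<le> m * M" using mult_mono[OF m1 M1] m1 by simp
  have Kpos: "0 < K" using m1 M1 by (simp add: K_def)
  have "log 2 K = log 2 (2 ^ 20) + log 2 ((m * M) ^ 4)"
    unfolding K_def using m1 M1 by (intro log_mult_pos) auto
  then have logK: "log 2 K = 20 + 4 * log 2 (m * M)"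
    using mM by (subst (asm) (1 2) log_nat_power) auto
  have K2: "2 \<le> K" unfolding K_def using one_le_power[OF mM, of 4] by simp
  define a where "a = log 2 c - log 2 K"
  have "\<exists>t::nat. a \<le> t \<and> t \<le> n \<and> real (card {L \<in> surj_lin_maps n t.
                  close_unif_linf (prob_image_unif L S) (F2vec t) (\<tau> * 2 powr (- real t))})
               \<ge> (1 - \<delta>) * real (card (surj_lin_maps n t))"
  proof (cases "a \<le> 0")
    \<comment> \<open>A nonpositive bound is met by t = 0, where the only value has probability
      1.\<close>
    case True
    have "close_unif_linf (prob_image_unif L S) (F2vec 0) (\<tau> * 2 powr (- real 0))"
      if "L \<in> surj_lin_maps n 0" for L
    proof -
      have "{x\<in>S. L x = []} = S"
        using that S_sub by (auto simp: surj_lin_maps_def F2vec_0)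
      then show ?thesis
        using c2 tau by (simp add: close_unif_linf_def F2vec_0 prob_image_unif_def c_def)
    qed
    then have "{L \<in> surj_lin_maps n 0. close_unif_linf (prob_image_unif L S) (F2vec 0) (\<tau> * 2 powr (- real 0))}
        = surj_lin_maps n 0" by blast
    then show ?thesis
      using True delta by (intro exI[of _ 0]) (simp add: mult_left_le_one_le)
  next
    case False
    define t where "t = nat \<lceil>a\<rceil>"
    have t: "a \<le> t" "t < a + 1" "0 < t" using False by (auto simp: t_def) linarith+
    define \<mu> where "\<mu> = card S / 2 ^ t"
    obtain b where b: "t \<le> 2 ^ b" "2 ^ b < 2 * t" using ex_power2_between[OF t(3)] by blast
    \<comment> \<open>Rounding a up adds less than 1, which log 2 K >= 1 makes up for, so t stays
      below log 2 |S|.\<close>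
    have "1 \<le> log 2 K" using K2 by simp
    then have tc: "t \<le> log 2 c" using t(2) by (simp add: a_def)
    have "2 ^ t \<le> c"
      using tc c2 by (simp add: le_log_iff powr_realpow)
    moreover have "c \<le> 2 ^ n"
    proof -
      have "card S \<le> 2 ^ n" using card_mono[OF finite_F2vec S_sub] by (simp add: card_F2vec)
      then show ?thesis unfolding c_def by (metis of_nat_le_iff of_nat_numeral of_nat_power)
    qed
    ultimately have "(2::real) ^ t \<le> 2 ^ n" by (rule order_trans)
    then have tn: "t \<le> n" by (rule power_le_imp_le_exp[rotated]) simp
    \<comment> \<open>The same rounding at most doubles 2^t, so the mean fibre size is at least K /
      2.\<close>
    have "2 ^ t = 2 powr (real t)" by (simp add: powr_realpow)
    also have "\<dots> \<le> 2 powr (a + 1)" using t(2) by (intro powr_mono) auto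
    also have "\<dots> = 2 * (c / K)"
      using c2 Kpos by (simp add: a_def powr_add powr_diff)
    finally have "K / 2 \<le> \<mu>"
      using Kpos by (simp add: \<mu>_def c_def field_simps)
    have "real (2 ^ b) \<le> real (2 * t)" using b(2) by (simp only: of_nat_le_iff)
    then have "2 ^ b \<le> 2 * m" using tc cm by simp
    then have "(2 ^ b)\<^sup>2 \<le> (2 * m)\<^sup>2" by (intro power_mono) auto
    then have "16 * (2 ^ b)\<^sup>2 \<le> 64 * m\<^sup>2" by (simp add: power_mult_distrib)
    \<comment> \<open>The fourth power in K is split: m^4 absorbs m^2, and M^4 absorbs
      \<open>\<delta>\<close> \<open>\<tau>\<^sup>2\<close>, because M^4 \<open>\<delta>\<close>
      \<open>\<tau>\<^sup>2\<close> >= M (\<open>\<tau>\<close> \<open>\<delta>\<close>)^2 >=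
      4.\<close>
    also have "\<dots> \<le> \<delta> * (\<tau>\<^sup>2 * (K / 2))"
    proof -
      have 1: "m\<^sup>2 \<le> m ^ 4" using m1 by (intro power_increasing) auto
      have "(\<tau> * \<delta>)\<^sup>2 \<le> \<delta> * \<tau>\<^sup>2"
        using delta tau by (simp add: power_mult_distrib power2_eq_square mult_left_le_one_le mult_ac)
      then have "M * (\<tau> * \<delta>)\<^sup>2 \<le> M ^ 4 * (\<delta> * \<tau>\<^sup>2)"
        using M1 self_le_power[OF M1, of 4] by (intro mult_mono) auto
      then have "1 \<le> M ^ 4 * (\<delta> * \<tau>\<^sup>2)" using MM by linarith
      then have "m\<^sup>2 * 1 \<le> m ^ 4 * (M ^ 4 * (\<delta> * \<tau>\<^sup>2))" using 1 m1 by (intro mult_mono) auto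
      then have 2: "m\<^sup>2 \<le> \<delta> * \<tau>\<^sup>2 * (m * M) ^ 4" by (simp add: power_mult_distrib mult_ac)
      have "\<delta> * (\<tau>\<^sup>2 * (K / 2)) = 2 ^ 19 * (\<delta> * \<tau>\<^sup>2 * (m * M) ^ 4)"
        unfolding K_def by simp
      moreover have "64 * m\<^sup>2 \<le> 2 ^ 19 * (\<delta> * \<tau>\<^sup>2 * (m * M) ^ 4)"
        using 2 m1 by (intro mult_mono) auto
      ultimately show ?thesis by linarith
    qed
    also have "\<dots> \<le> \<delta> * (\<tau>\<^sup>2 * \<mu>)"
      using \<open>K / 2 \<le> \<mu>\<close> delta by (intro mult_left_mono) auto
    finally have size': "16 * (2 ^ b)\<^sup>2 \<le> \<delta> * (\<tau>\<^sup>2 * \<mu>)" .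
    have "0 < \<mu>" using \<open>K / 2 \<le> \<mu>\<close> Kpos by linarith
    from close_unif_surj_fraction[OF S_sub \<mu>_def this tau delta size' b(1)] t(1) tn
    show ?thesis by blast
  qed
  then show ?thesis unfolding a_def logK M_def c_def by (simp add: algebra_simps)
qed

end
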